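(* For every $\lambda,k,n\geq 1$, there exists an $n$-vertex directed graph $G$ with a designated source vertex $s$ such that every $(\lambda,k)$-FT-BFP of $G$ (in particular an optimal one) contains $\Omega(\min\{2^k\lambda n,n^2\})$ edges.
   Context: All edges have unit capacity; $\textsc{max-flow}(s,t,G)$ denotes the maximum number of pairwise edge-disjoint $s$-to-$t$ paths in $G$. For $F\subseteq E$, $G\setminus F$ is $G$ with the edges of $F$ deleted. Given a directed graph $G=(V,E)$ with designated source $s$, a $(\lambda,k)$-FT-BFP of $G$ is a subgraph $H=(V,E_H)$ with $E_H\subseteq E$ such that for every $F\subseteq E$ with $|F|\leq k$ and every $t\in V$: if $\textsc{max-flow}(s,t,G\setminus F)\leq\lambda$ then $\textsc{max-flow}(s,t,H\setminus F)=\textsc{max-flow}(s,t,G\setminus F)$, and otherwise $\textsc{max-flow}(s,t,H\setminus F)\geq\lambda$.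
   Formalization: The edge bound, with one absolute constant for all λ, k, n, is claimed only for n ≥ 2: for n = 1 the edgeless one-vertex graph is itself a (λ,k)-FT-BFP with 0 edges, while min{2^k λ n, n²} = 1. *)

theory Defs
  imports Complex_Main "Graph_Theory.Graph_Theory"
begin

definition del_arcs :: "('a, 'b) pre_digraph \<Rightarrow> 'b set \<Rightarrow> ('a, 'b) pre_digraph" where
  "del_arcs G F = \<lparr> verts = verts G, arcs = arcs G - F, tail = tail G, head = head G \<rparr>"

text \<open>
  Only meaningful for finite digraphs, where the set under \<^const>\<open>Max\<close> is finite and
  nonempty. For \<open>s = t\<close> the empty path is the only one, so the value is 1 in every graph
  containing \<open>s\<close>, and the target \<open>s\<close> imposes no condition on a preserver.
\<close>
definition max_flow :: "'a \<Rightarrow> 'a \<Rightarrow> ('a, 'b) pre_digraph \<Rightarrow> nat" where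
  "max_flow s t G =
     Max {card P | P. P \<subseteq> {p. pre_digraph.apath G s p t} \<and>
                      pairwise (\<lambda>p q. set p \<inter> set q = {}) P}"

definition ft_bfp ::
    "nat \<Rightarrow> nat \<Rightarrow> ('a, 'b) pre_digraph \<Rightarrow> 'a \<Rightarrow> ('a, 'b) pre_digraph \<Rightarrow> bool" where
  "ft_bfp l k G s H \<longleftrightarrow>
     spanning H G \<and>
     (\<forall>F t. F \<subseteq> arcs G \<and> finite F \<and> card F \<le> k \<and> t \<in> verts G \<longrightarrow>
        (if max_flow s t (del_arcs G F) \<le> l
         then max_flow s t (del_arcs H F) = max_flow s t (del_arcs G F)
         else max_flow s t (del_arcs H F) \<ge> l))"

end

theory Submission
  imports Defs
begin

text \<open>
  Take \<open>a \<le> l\<close> disjoint binary trees of depth at most \<open>k\<close>, with \<open>m\<close> leaves altogether, attach each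
  root to the source by one arc, and join every leaf to every vertex of a set \<open>X\<close> of sinks. Let \<open>x\<close>
  be a sink and \<open>j\<close> a leaf. Deleting the at most \<open>k\<close> arcs that branch off the path from the root to
  \<open>j\<close> leaves \<open>j\<close> as the only reachable leaf of its tree, so the flow to \<open>x\<close> is still \<open>a\<close>, but it
  drops to \<open>a - 1\<close> if the arc \<open>(j, x)\<close> is missing. Hence a preserver contains all arcs between
  leaves and sinks. The choices \<open>a = min l (n div 4)\<close> and \<open>m = min (2 ^ k * l) (n div 4)\<close> give
  the bound.
\<close>

section \<open>Bounding the flow by disjoint paths and by cuts\<close>

lemma max_flow_set_finite:
  assumes "fin_digraph G"
  shows "finite {card P | P. P \<subseteq> {p. pre_digraph.apath G s p t} \<and>
                      pairwise (\<lambda>p q. set p \<inter> set q = {}) P}"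
    (is "finite ?A")
proof -
  have "?A \<subseteq> card ` Pow {p. pre_digraph.apath G s p t}"
    by auto
  moreover have "finite {p. pre_digraph.apath G s p t}"
    using assms by (rule fin_digraph.apaths_finite)
  ultimately show ?thesis
    by (meson finite_Pow_iff finite_imageI finite_subset)
qed

lemma card_le_max_flow:
  assumes "fin_digraph G"
    and "\<And>p. p \<in> P \<Longrightarrow> pre_digraph.apath G s p t"
    and "pairwise (\<lambda>p q. set p \<inter> set q = {}) P"
  shows "card P \<le> max_flow s t G"
  unfolding max_flow_def
  by (rule Max_ge[OF max_flow_set_finite[OF assms(1)]]) (use assms(2,3) in blast)

lemma (in wf_digraph) awalk_leaves_set:
  assumes "awalk u p v" "u \<in> S" "v \<notin> S"
  shows "\<exists>e\<in>set p. e \<in> arcs G \<and> tail G e \<in> S \<and> head G e \<notin> S"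
  using assms
proof (induction p arbitrary: u)
  case Nil
  then show ?case by (simp add: awalk_Nil_iff)
next
  case (Cons e p)
  then show ?case by (cases "head G e \<in> S") (auto simp: awalk_Cons_iff)
qed

text \<open>The easy half of Menger's theorem: each path uses an arc leaving \<open>S\<close>, and
  disjointness makes the choice of such an arc injective. Allowing a superset \<open>C\<close> of
  the cut spares computing the cut exactly.\<close>

lemma max_flow_le_cut:
  assumes "fin_digraph G" and "s \<in> S" and "t \<notin> S"
    and sub: "{e \<in> arcs G. tail G e \<in> S \<and> head G e \<notin> S} \<subseteq> C" and "finite C"
  shows "max_flow s t G \<le> card C"
proof -
  interpret fin_digraph G by fact
  have bound: "card P \<le> card C"
    if P: "P \<subseteq> {p. apath s p t}" and disj: "pairwise (\<lambda>p q. set p \<inter> set q = {}) P" for P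
  proof -
    have "\<exists>e. e \<in> set p \<and> e \<in> C" if "p \<in> P" for p
      using awalk_leaves_set[OF awalkI_apath assms(2,3)] P sub that by blast
    then obtain f where f: "\<And>p. p \<in> P \<Longrightarrow> f p \<in> set p \<and> f p \<in> C"
      by metis
    have "inj_on f P"
    proof (rule inj_onI, rule ccontr)
      fix p q assume "p \<in> P" "q \<in> P" "f p = f q" "p \<noteq> q"
      then have "set p \<inter> set q = {}" using pairwiseD[OF disj] by simp
      moreover have "f p \<in> set p" "f q \<in> set q" using f \<open>p \<in> P\<close> \<open>q \<in> P\<close> by auto
      ultimately show False using \<open>f p = f q\<close> by auto
    qed
    then show ?thesis
      using f \<open>finite C\<close> by (intro card_inj_on_le) auto
  qed
  show ?thesis
    unfolding max_flow_def
  proof (rule Max.boundedI[OF max_flow_set_finite[OF assms(1)]])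
    show "{card P | P. P \<subseteq> {p. apath s p t} \<and> pairwise (\<lambda>p q. set p \<inter> set q = {}) P} \<noteq> {}"
      by (auto intro: exI[of _ "{}"])
  qed (use bound in auto)
qed

lemma fin_digraph_del_arcs:
  assumes "fin_digraph G"
  shows "fin_digraph (del_arcs G F)"
proof -
  interpret fin_digraph G by fact
  show ?thesis by unfold_locales (auto simp: del_arcs_def)
qed

lemma spanning_fin_digraph:
  assumes "fin_digraph G" "spanning H G"
  shows "fin_digraph H"
proof -
  interpret G: fin_digraph G by fact
  have H: "wf_digraph H" "arcs H \<subseteq> arcs G" "verts H = verts G"
    using assms(2) by (auto simp: spanning_def subgraph_def)
  show ?thesis
    by (rule wf_digraph.fin_digraphI[OF H(1)]) (use H finite_subset[OF H(2)] in auto)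
qed

section \<open>The heap-numbered forest\<close>

locale heap_forest =
  fixes a m N :: nat
  assumes a_pos: "1 \<le> a" and a_le_m: "a \<le> m" and m_le_N: "2 * m \<le> N"
begin

text \<open>
  Heap numbering: the parent of \<open>v\<close> is \<open>v div 2\<close>. Cutting the heap off below \<open>a\<close> leaves the \<open>a\<close>
  trees rooted at \<open>a, \<dots>, 2a - 1\<close>, whose leaves are \<open>m, \<dots>, 2m - 1\<close>. The source is \<open>0\<close>
  and the sinks are \<open>2m, \<dots>, N - 1\<close>.
\<close>

definition forest_arcs :: "(nat \<times> nat) set" where
  "forest_arcs = {(0, r) | r. a \<le> r \<and> r < 2 * a} \<union> {(v div 2, v) | v. 2 * a \<le> v \<and> v < 2 * m}
     \<union> {m..<2 * m} \<times> {2 * m..<N}"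

definition heap_graph :: "(nat, nat \<times> nat) pre_digraph" where
  "heap_graph = \<lparr> verts = insert 0 {a..<N}, arcs = forest_arcs, tail = fst, head = snd \<rparr>"

text \<open>Ancestry is by repeated halving only and ignores the cut at \<open>a\<close>: every
  vertex is its own ancestor (\<open>d = 0\<close>), and \<open>0\<close> is an ancestor of every
  number.\<close>

definition ancestor :: "nat \<Rightarrow> nat \<Rightarrow> bool" where
  "ancestor v w \<longleftrightarrow> (\<exists>d. v = w div 2 ^ d)"

text \<open>These arcs enter the siblings of the vertices strictly below the root on the path to the
  leaf \<open>j\<close>. The bound \<open>2 * a \<le> w\<close> leaves the arcs out of the source
  intact.\<close>

definition branch_arcs :: "nat \<Rightarrow> (nat \<times> nat) set" where
  "branch_arcs j =
     {(w div 2, w) | w. 2 * a \<le> w \<and> w < 2 * m \<and> ancestor (w div 2) j \<and> \<not> ancestor w j}"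

section \<open>Ancestors and roots\<close>

lemma ancestor_refl [simp]: "ancestor v v"
  unfolding ancestor_def by (rule exI[of _ 0]) simp

lemma ancestor_half:
  assumes "ancestor v w"
  shows "ancestor (v div 2) w"
proof -
  obtain d where "v = w div 2 ^ d" using assms by (auto simp: ancestor_def)
  then have "v div 2 = w div 2 ^ Suc d" by (simp add: div_mult2_eq[symmetric] mult.commute)
  then show ?thesis unfolding ancestor_def by blast
qed

lemma ancestor_trans:
  assumes "ancestor u v" "ancestor v w"
  shows "ancestor u w"
proof -
  obtain d e where "u = v div 2 ^ d" "v = w div 2 ^ e" using assms by (auto simp: ancestor_def)
  then have "u = w div 2 ^ (e + d)" by (simp add: div_mult2_eq power_add)
  then show ?thesis unfolding ancestor_def by blast
qed

lemma ancestor_cases: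
  assumes "ancestor v w"
  obtains "v = w" | d where "v = w div 2 ^ d div 2"
proof -
  obtain d where d: "v = w div 2 ^ d" using assms by (auto simp: ancestor_def)
  show thesis
  proof (cases d)
    case 0
    then show thesis using d that(1) by simp
  next
    case (Suc d')
    then have "v = w div 2 ^ d' div 2" using d by (simp add: div_mult2_eq[symmetric] mult.commute)
    then show thesis by (rule that(2))
  qed
qed

text \<open>Halving a number below \<open>2 * a\<close> gives one below \<open>a\<close>, so a chain
  of halvings meets the range of roots at most once. This makes the trees disjoint.\<close>

lemma root_unique:
  assumes "ancestor r v" "ancestor r' v" "a \<le> r" "r < 2 * a" "a \<le> r'" "r' < 2 * a"
  shows "r = r'"
proof -
  have le: "d = e" if "d \<le> e" "a \<le> v div 2 ^ e" "v div 2 ^ d < 2 * a" for d e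
  proof (rule ccontr)
    assume "d \<noteq> e"
    then have "d < e" using that(1) by simp
    then obtain f where "e = d + Suc f" by (auto dest: less_imp_Suc_add)
    then have "v div 2 ^ e = v div 2 ^ d div 2 div 2 ^ f"
      by (simp add: power_add div_mult2_eq[symmetric] ac_simps)
    also have "\<dots> \<le> v div 2 ^ d div 2" by simp
    also have "\<dots> < a" using that(3) by (simp add: div_less_iff_less_mult mult.commute)
    finally show False using that(2) by simp
  qed
  obtain d e where "r = v div 2 ^ d" "r' = v div 2 ^ e" using assms by (auto simp: ancestor_def)
  then show ?thesis using le[of d e] le[of e d] assms(3-) by (metis nat_le_linear)
qed

text \<open>Halving a number that is at least \<open>2 * a\<close> cannot fall below
  \<open>a\<close>, so the chain of ancestors does not jump over the roots.\<close>

lemma exists_root: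
  assumes "a \<le> v"
  shows "\<exists>r. ancestor r v \<and> a \<le> r \<and> r < 2 * a"
  using assms
proof (induction v rule: less_induct)
  case (less v)
  show ?case
  proof (cases "v < 2 * a")
    case True
    then show ?thesis using less.prems by (intro exI[of _ v]) simp
  next
    case False
    have "v div 2 < v" "a \<le> v div 2" using False a_pos by auto
    then obtain r where "ancestor r (v div 2)" "a \<le> r" "r < 2 * a" using less.IH by blast
    then show ?thesis using ancestor_trans ancestor_half[OF ancestor_refl] by blast
  qed
qed

section \<open>The graph and its sets of branch arcs\<close>

lemma digraph_heap_graph: "digraph heap_graph"
proof
  have "forest_arcs \<subseteq> ({..<N} \<times> {..<N})"
    using a_pos a_le_m m_le_N by (auto simp: forest_arcs_def)
  then show "finite (arcs heap_graph)"
    by (auto simp: heap_graph_def intro: finite_subset)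
qed (use a_pos a_le_m m_le_N in \<open>auto simp: heap_graph_def forest_arcs_def arc_to_ends_def\<close>)

lemmas fin_digraph_heap_graph = digraph.axioms(1)[OF digraph_heap_graph]

lemma card_verts_heap_graph: "card (verts heap_graph) = Suc (N - a)"
  using a_pos by (simp add: heap_graph_def)

lemma branch_arcs_subset: "branch_arcs j \<subseteq> arcs heap_graph"
  by (auto simp: branch_arcs_def heap_graph_def forest_arcs_def)

text \<open>There is at most one branch arc per level \<open>d\<close>, namely the one into the
  sibling of \<open>j div 2 ^ d\<close>. Since \<open>j < 2 * m \<le> 2 ^ k * (2 * a)\<close>, the
  root range or below is reached after \<open>k\<close> halvings, so only levels
  \<open>d < k\<close> occur.\<close>

lemma card_branch_arcs:
  assumes "m \<le> j" "j < 2 * m" "m \<le> 2 ^ k * a"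
  shows "card (branch_arcs j) \<le> k" and "finite (branch_arcs j)"
proof -
  \<comment> \<open>\<open>sib i\<close> is the only other number with the same half as
    \<open>i\<close>.\<close>
  define sib :: "nat \<Rightarrow> nat" where "sib i = (if even i then i + 1 else i - 1)" for i
  have "branch_arcs j \<subseteq> (\<lambda>d. (j div 2 ^ d div 2, sib (j div 2 ^ d))) ` {..<k}"
  proof
    fix e assume "e \<in> branch_arcs j"
    then obtain w where e: "e = (w div 2, w)" and w: "2 * a \<le> w" "w < 2 * m"
      and anc: "ancestor (w div 2) j" "\<not> ancestor w j"
      unfolding branch_arcs_def by blast
    from anc(1) show "e \<in> (\<lambda>d. (j div 2 ^ d div 2, sib (j div 2 ^ d))) ` {..<k}"
    proof (cases rule: ancestor_cases)
      case 1
      then show ?thesis using w assms by auto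
    next
      case (2 d)
      define i where "i = j div 2 ^ d"
      have "w \<noteq> i" using anc(2) unfolding i_def ancestor_def by blast
      then have sib: "w = sib i" using 2 unfolding sib_def i_def[symmetric] by presburger
      have "2 * a \<le> i" using w(1) 2 unfolding i_def[symmetric] by presburger
      have "d < k"
      proof (rule ccontr)
        assume "\<not> d < k"
        then have "i \<le> j div 2 ^ k"
          unfolding i_def by (intro div_le_mono2) (auto intro: power_increasing)
        also have "\<dots> < 2 * a"
          using assms by (simp add: div_less_iff_less_mult mult.commute mult.left_commute)
        finally show False using \<open>2 * a \<le> i\<close> by simp
      qed
      then show ?thesis using e sib 2 unfolding i_def by blast
    qed
  qed
  then show "card (branch_arcs j) \<le> k" "finite (branch_arcs j)"
    using surj_card_le[of "{..<k}" "branch_arcs j"] finite_surj[of "{..<k}" "branch_arcs j"]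
    by auto
qed

section \<open>Flow to a sink after deleting branch arcs\<close>

text \<open>Descend from \<open>v\<close>: on the path to \<open>j\<close>, continue along that
  path; off it, any child will do, since branch arcs start at ancestors of \<open>j\<close>. The
  claim on \<open>fst e\<close> confines the walk to the subtree of \<open>v\<close>, which later
  gives disjointness.\<close>

lemma awalk_to_sink:
  assumes j: "m \<le> j" "j < 2 * m" and x: "2 * m \<le> x" "x < N"
    and v: "a \<le> v" "v < 2 * m"
  shows "\<exists>p. pre_digraph.awalk (del_arcs heap_graph (branch_arcs j)) v p x \<and>
             (\<forall>e\<in>set p. ancestor v (fst e))"
  using v
proof (induction "2 * m - v" arbitrary: v rule: less_induct)
  case less
  interpret D: fin_digraph "del_arcs heap_graph (branch_arcs j)"
    by (rule fin_digraph_del_arcs[OF fin_digraph_heap_graph])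
  show ?case
  proof (cases "m \<le> v")
    case True
    then have "D.awalk v [(v, x)] x"
      using less.prems x by (auto simp: D.awalk_simps) 
        (auto simp: del_arcs_def heap_graph_def forest_arcs_def branch_arcs_def)
    then show ?thesis by (intro exI[of _ "[(v, x)]"]) simp
  next
    case False
    obtain c where c: "c div 2 = v" "(v, c) \<notin> branch_arcs j"
    proof (cases "ancestor v j")
      case True
      then show thesis
      proof (cases rule: ancestor_cases)
        case 1
        then show thesis using False j by simp
      next
        case (2 d)
        moreover have "ancestor (j div 2 ^ d) j" unfolding ancestor_def by blast
        ultimately show thesis using that[of "j div 2 ^ d"] by (auto simp: branch_arcs_def)
      qed
    next
      case not_anc: False
      show thesis by (rule that[of "2 * v"]) (use not_anc in \<open>auto simp: branch_arcs_def\<close>)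
    qed
    have c_range: "2 * a \<le> c" "c < 2 * m" "v < c" using c(1) less.prems False a_pos by auto
    then obtain p where p: "D.awalk c p x" "\<forall>e\<in>set p. ancestor c (fst e)"
      using less.hyps[of c] less.prems(2) by fastforce
    have "(v, c) \<in> arcs (del_arcs heap_graph (branch_arcs j))"
      using c c_range by (auto simp: del_arcs_def heap_graph_def forest_arcs_def)
    then have "D.awalk v ((v, c) # p) x"
      using p(1) by (simp add: D.awalk_Cons_iff) (simp add: del_arcs_def heap_graph_def)
    moreover have "ancestor v u" if "ancestor c u" for u
      using ancestor_half[OF that] c(1) by simp
    ultimately show ?thesis using p(2) by (intro exI[of _ "(v, c) # p"]) auto
  qed
qed

text \<open>The arcs out of the source form a cut of size \<open>a\<close>, and every tree still
  supplies one path to \<open>x\<close>.\<close>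

lemma max_flow_del_branch_arcs:
  assumes j: "m \<le> j" "j < 2 * m" and x: "2 * m \<le> x" "x < N"
  shows "max_flow 0 x (del_arcs heap_graph (branch_arcs j)) = a"
proof (rule antisym)
  let ?D = "del_arcs heap_graph (branch_arcs j)"
  interpret D: fin_digraph ?D
    by (rule fin_digraph_del_arcs[OF fin_digraph_heap_graph])
  have "max_flow 0 x ?D \<le> card (Pair 0 ` {a..<2 * a} :: (nat \<times> nat) set)"
    by (rule max_flow_le_cut[where S = "{0}"])
      (use a_pos a_le_m x D.fin_digraph_axioms in
        \<open>auto simp: del_arcs_def heap_graph_def forest_arcs_def\<close>)
  also have "\<dots> = a" by (simp add: card_image inj_on_def)
  finally show "max_flow 0 x ?D \<le> a" .

  have "\<exists>q. D.apath 0 q x \<and> (\<forall>e\<in>set q. e = (0, r) \<or> ancestor r (fst e))"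
    if r: "r \<in> {a..<2 * a}" for r
  proof -
    obtain p where p: "D.awalk r p x" "\<forall>e\<in>set p. ancestor r (fst e)"
      using awalk_to_sink[OF j x, of r] r a_le_m by auto
    have "(0, r) \<in> arcs ?D"
      using r a_pos by (auto simp: del_arcs_def heap_graph_def forest_arcs_def branch_arcs_def)
    then have w: "D.awalk 0 ((0, r) # p) x"
      using p(1) by (simp add: D.awalk_Cons_iff) (simp add: del_arcs_def heap_graph_def)
    \<comment> \<open>Flow counts simple paths; shortening the walk only drops arcs, so the
      confinement to one tree survives.\<close>
    then show ?thesis
      using D.apath_awalk_to_apath[OF w] D.awalk_to_apath_subset[OF w] p(2)
      by (intro exI[of _ "D.awalk_to_apath ((0, r) # p)"]) auto
  qed
  then obtain q where q: "\<And>r. r \<in> {a..<2 * a} \<Longrightarrow> D.apath 0 (q r) x"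
    "\<And>r e. r \<in> {a..<2 * a} \<Longrightarrow> e \<in> set (q r) \<Longrightarrow> e = (0, r) \<or> ancestor r (fst e)"
    by metis
  have not_anc_0: "\<not> ancestor r 0" if "r \<in> {a..<2 * a}" for r
    using that a_pos by (auto simp: ancestor_def)
  have disj: "set (q r) \<inter> set (q r') = {}"
    if "r \<in> {a..<2 * a}" "r' \<in> {a..<2 * a}" "r \<noteq> r'" for r r'
  proof (rule ccontr)
    assume "set (q r) \<inter> set (q r') \<noteq> {}"
    then obtain e where "e \<in> set (q r)" "e \<in> set (q r')" by blast
    then show False
      using q(2)[of r e] q(2)[of r' e] that not_anc_0[of r] not_anc_0[of r']
        root_unique[of r "fst e" r'] by auto
  qed
  \<comment> \<open>The empty path is disjoint from itself, so injectivity of \<open>q\<close> needs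
    nonempty paths.\<close>
  have ne: "q r \<noteq> []" if "r \<in> {a..<2 * a}" for r
    using q(1)[OF that] x a_pos a_le_m by (auto simp: D.apath_Nil_iff)
  have "inj_on q {a..<2 * a}"
    using disj ne by (intro inj_onI) (metis Int_absorb set_empty)
  then have "a = card (q ` {a..<2 * a})" by (simp add: card_image)
  also have "\<dots> \<le> max_flow 0 x ?D"
    by (rule card_le_max_flow[OF D.fin_digraph_axioms])
      (use q(1) disj in \<open>fastforce simp: pairwise_def\<close>)+
  finally show "a \<le> max_flow 0 x ?D" .
qed

text \<open>The tree of \<open>j\<close> no longer reaches \<open>x\<close>, so only the source arcs
  to the other \<open>a - 1\<close> roots cross a suitable cut. Putting the other sinks on the
  source side keeps the arcs from \<open>j\<close> to them from crossing.\<close>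

lemma max_flow_without_leaf_arc:
  assumes j: "m \<le> j" "j < 2 * m" and x: "2 * m \<le> x" "x < N"
    and H: "spanning H heap_graph" "(j, x) \<notin> arcs H"
  shows "max_flow 0 x (del_arcs H (branch_arcs j)) < a"
proof -
  let ?D = "del_arcs H (branch_arcs j)"
  have fin: "fin_digraph ?D"
    by (rule fin_digraph_del_arcs[OF spanning_fin_digraph[OF fin_digraph_heap_graph H(1)]])
  have HG: "arcs H \<subseteq> forest_arcs" "tail H = fst" "head H = snd"
    using H(1) by (auto simp: spanning_def subgraph_def compatible_def heap_graph_def)
  obtain r where r: "ancestor r j" "a \<le> r" "r < 2 * a"
    using exists_root[of j] j a_le_m by auto
  \<comment> \<open>The source, the path from \<open>r\<close> to \<open>j\<close>, and the sinks other than \<open>x\<close>.\<close>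
  define S where "S = {0} \<union> {v. ancestor v j} \<union> {2 * m..} - {x}"
  have "max_flow 0 x ?D \<le> card (Pair 0 ` ({a..<2 * a} - {r}) :: (nat \<times> nat) set)"
  proof (rule max_flow_le_cut[where S = S, OF fin])
    show "0 \<in> S" "x \<notin> S" using x a_pos a_le_m by (auto simp: S_def)
    show "{e \<in> arcs ?D. tail ?D e \<in> S \<and> head ?D e \<notin> S} \<subseteq> Pair 0 ` ({a..<2 * a} - {r})"
    proof
      fix e assume "e \<in> {e \<in> arcs ?D. tail ?D e \<in> S \<and> head ?D e \<notin> S}"
      then obtain u w where e: "e = (u, w)" and arc: "(u, w) \<in> arcs H" "(u, w) \<notin> branch_arcs j"
        and S: "u \<in> S" "w \<notin> S"
        using HG by (cases e) (auto simp: del_arcs_def)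
      from arc(1) HG(1) consider
          (root) "u = 0" "a \<le> w" "w < 2 * a"
        | (tree) "2 * a \<le> w" "w < 2 * m" "u = w div 2"
        | (leaf) "m \<le> u" "u < 2 * m" "2 * m \<le> w"
        unfolding forest_arcs_def by auto
      then show "e \<in> Pair 0 ` ({a..<2 * a} - {r})"
      proof cases
        case root
        have "r \<in> S" using r x a_le_m by (auto simp: S_def)
        then have "w \<noteq> r" using S(2) by blast
        then show ?thesis using root e by auto
      next
        case tree
        then have "ancestor u j" using S(1) a_pos a_le_m by (auto simp: S_def)
        then have "ancestor w j" using tree arc(2) by (auto simp: branch_arcs_def)
        then have "w \<in> S" using tree x by (auto simp: S_def)
        then show ?thesis using S(2) by blast
      next
        case leaf
        then have "ancestor u j" using S(1) a_pos a_le_m by (auto simp: S_def)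
        then have "u = j"
        proof (cases rule: ancestor_cases)
          \<comment> \<open>A proper ancestor of \<open>j\<close> is at most
            \<open>j div 2 < m\<close>, hence not a leaf.\<close>
          case (2 d)
          have "j div 2 ^ d \<le> j" by simp
          then have "u < m" using 2 j by linarith
          then show ?thesis using leaf by simp
        qed
        moreover have "w = x" using S(2) leaf by (auto simp: S_def)
        ultimately show ?thesis using arc(1) H(2) by blast
      qed
    qed
  qed simp
  also have "\<dots> = a - 1" using r by (simp add: card_image inj_on_def)
  also have "\<dots> < a" using a_pos by simp
  finally show ?thesis .
qed

lemma card_arcs_ft_bfp_heap_graph:
  assumes "a \<le> l" "m \<le> 2 ^ k * a" and H: "ft_bfp l k heap_graph 0 H"
  shows "m * (N - 2 * m) \<le> card (arcs H)"
proof -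
  have span: "spanning H heap_graph" using H by (simp add: ft_bfp_def)
  have "{m..<2 * m} \<times> {2 * m..<N} \<subseteq> arcs H"
  proof clarify
    fix j x assume "j \<in> {m..<2 * m}" "x \<in> {2 * m..<N}"
    then have j: "m \<le> j" "j < 2 * m" and x: "2 * m \<le> x" "x < N" by auto
    show "(j, x) \<in> arcs H"
    proof (rule ccontr)
      assume "(j, x) \<notin> arcs H"
      then have "max_flow 0 x (del_arcs H (branch_arcs j)) < a"
        using max_flow_without_leaf_arc[OF j x span] by blast
      \<comment> \<open>Because the remaining flow \<open>a\<close> is at most \<open>l\<close>, the
        preserver must match it exactly.\<close>
      moreover have "max_flow 0 x (del_arcs H (branch_arcs j)) = a"
      proof -
        have "x \<in> verts heap_graph" using x a_le_m by (simp add: heap_graph_def)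
        then show ?thesis
          using H branch_arcs_subset[of j] card_branch_arcs[OF j assms(2)] \<open>a \<le> l\<close>
            max_flow_del_branch_arcs[OF j x]
          unfolding ft_bfp_def by metis
      qed
      ultimately show False by simp
    qed
  qed
  moreover have "finite (arcs H)"
    using spanning_fin_digraph[OF fin_digraph_heap_graph span] by (rule fin_digraph.finite_arcs)
  ultimately have "card ({m..<2 * m} \<times> {2 * m..<N}) \<le> card (arcs H)" by (rule card_mono[rotated])
  then show ?thesis by simp
qed

end

section \<open>Small orders and the choice of parameters\<close>

text \<open>Serves \<open>n = 2\<close> and \<open>n = 3\<close>, where \<open>n div 4 = 0\<close>
  leaves no room for a forest; one forced arc suffices there because
  \<open>n * n / 16 < 1\<close>.\<close>

lemma single_arc_graph:
  fixes n :: nat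
  assumes "n \<ge> 2"
  defines "G \<equiv> \<lparr> verts = {..<n}, arcs = {(0, 1)}, tail = fst, head = snd \<rparr>"
  shows "digraph G" and "l \<ge> 1 \<Longrightarrow> ft_bfp l k G 0 H \<Longrightarrow> 1 \<le> card (arcs H)"
proof -
  show dg: "digraph G"
    using assms(1) by unfold_locales (auto simp: G_def)
  then interpret digraph G .
  assume "l \<ge> 1" and H: "ft_bfp l k G 0 H"
  have span: "spanning H G" using H by (simp add: ft_bfp_def)
  have del: "del_arcs K {} = K" for K :: "(nat, nat \<times> nat) pre_digraph"
    by (simp add: del_arcs_def)
  have fin: "fin_digraph H" by (rule spanning_fin_digraph[OF fin_digraph_axioms span])
  have "max_flow 0 1 G \<le> card {(0 :: nat, 1 :: nat)}"
    by (rule max_flow_le_cut[where S = "{0}", OF fin_digraph_axioms]) (auto simp: G_def)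
  moreover have "card {[(0 :: nat, 1 :: nat)]} \<le> max_flow 0 1 G"
    by (rule card_le_max_flow[OF fin_digraph_axioms])
      (use assms(1) in \<open>auto simp: apath_simps, auto simp: G_def\<close>)
  ultimately have flow: "max_flow 0 1 G = 1" by simp
  have "max_flow 0 1 H = max_flow 0 1 G"
    using H[unfolded ft_bfp_def, THEN conjunct2, rule_format, of "{}" 1] flow \<open>l \<ge> 1\<close> assms(1)
    by (simp add: del) (simp add: G_def)
  moreover have "max_flow 0 1 H \<le> card (arcs H)"
    by (rule max_flow_le_cut[where S = "{0}", OF fin])
      (use fin_digraph.finite_arcs[OF fin] in auto)
  ultimately show "1 \<le> card (arcs H)" using flow by simp
qed

theorem theorem2:
  shows "\<exists>c::real. c > 0 \<and>
    (\<forall>(l::nat) (k::nat) (n::nat). l \<ge> 1 \<and> k \<ge> 1 \<and> n \<ge> 1 \<longrightarrow>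
      (\<exists>(G :: (nat, nat \<times> nat) pre_digraph) (s::nat).
         digraph G \<and> card (verts G) = n \<and> s \<in> verts G \<and>
         (n \<ge> 2 \<longrightarrow>
           (\<forall>H. ft_bfp l k G s H \<longrightarrow>
              real (card (arcs H)) \<ge> c * min (2 ^ k * real l * real n) ((real n)\<^sup>2)))))"
\<comment> \<open>The constant is \<open>1/8 * 1/2\<close>: for \<open>n \<ge> 4\<close> there are
  at least \<open>min (2 ^ k * l) (n / 8)\<close> leaves and at least \<open>n / 2\<close>
  sinks.\<close>
proof (intro exI[of _ "1/16 :: real"] conjI allI impI)
  fix l k n :: nat
  assume "l \<ge> 1 \<and> k \<ge> 1 \<and> n \<ge> 1"
  then have l: "l \<ge> 1" and n: "n \<ge> 1" by auto
  consider "n = 1" | "n = 2 \<or> n = 3" | "n \<ge> 4" using n by linarith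
  then show "\<exists>(G :: (nat, nat \<times> nat) pre_digraph) (s::nat).
         digraph G \<and> card (verts G) = n \<and> s \<in> verts G \<and>
         (n \<ge> 2 \<longrightarrow>
           (\<forall>H. ft_bfp l k G s H \<longrightarrow>
              real (card (arcs H)) \<ge> 1/16 * min (2 ^ k * real l * real n) ((real n)\<^sup>2)))"
  proof cases
    \<comment> \<open>Only the graph is asked for here: a loop-free graph on one vertex has no arcs,
      so no positive bound could hold.\<close>
    case 1
    have "digraph \<lparr> verts = {0 :: nat}, arcs = {} :: (nat \<times> nat) set, tail = fst, head = snd \<rparr>"
      by unfold_locales auto
    then show ?thesis using 1 by (intro exI conjI) auto
  next
    case 2
    let ?G = "\<lparr> verts = {..<n}, arcs = {(0, 1)}, tail = fst, head = snd \<rparr>"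
    have "1/16 * min (2 ^ k * real l * real n) ((real n)\<^sup>2) \<le> 1/16 * (real n)\<^sup>2"
      by simp
    also have "\<dots> \<le> 1" using 2 by auto
    finally have "1/16 * min (2 ^ k * real l * real n) ((real n)\<^sup>2) \<le> 1" .
    moreover have "digraph ?G" "\<And>H. ft_bfp l k ?G 0 H \<Longrightarrow> 1 \<le> real (card (arcs H))"
      using single_arc_graph(1)[of n] single_arc_graph(2)[of n l k] 2 l by fastforce+
    ultimately show ?thesis
      using 2 by (intro exI[of _ ?G] exI[of _ 0]) (fastforce intro: order_trans)
  next
    case 3
    define a where "a = min l (n div 4)"
    define m where "m = min (2 ^ k * l) (n div 4)"
    \<comment> \<open>The vertices are \<open>0\<close> and \<open>a, ..., N - 1\<close>, so this
      makes their number \<open>n\<close>.\<close>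
    define N where "N = n + a - 1"
    have le: "l \<le> 2 ^ k * l" by simp
    have "1 \<le> a" using l 3 by (auto simp: a_def)
    have "a \<le> m" using le unfolding a_def m_def by linarith
    have "2 * m \<le> n div 2" unfolding m_def by linarith
    interpret heap_forest a m N
      by unfold_locales (use \<open>1 \<le> a\<close> \<open>a \<le> m\<close> \<open>2 * m \<le> n div 2\<close> in \<open>auto simp: N_def\<close>)
    have m_le: "m \<le> 2 ^ k * a"
    proof -
      have "n div 4 \<le> 2 ^ k * (n div 4)" by simp
      then have "m \<le> 2 ^ k * (n div 4)" "m \<le> 2 ^ k * l" unfolding m_def by linarith+
      then show ?thesis unfolding a_def min_def by simp
    qed
    have bound: "1/16 * min (2 ^ k * real l * real n) ((real n)\<^sup>2) \<le> real (card (arcs H))"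
      if "ft_bfp l k heap_graph 0 H" for H
    proof -
      have "min (2 ^ k * real l) (real n / 8) \<le> real m"
      proof -
        \<comment> \<open>Rounding costs at most a factor of two once \<open>n \<ge> 4\<close>; the
          tightest case is \<open>n = 7\<close>.\<close>
        have "n \<le> 8 * (n div 4)" using 3 by presburger
        then have "real n / 8 \<le> real (n div 4)" by linarith
        then show ?thesis by (auto simp: m_def min_def)
      qed
      moreover have "real n / 2 \<le> real (N - 2 * m)"
      proof -
        have "4 * m \<le> n" using \<open>2 * m \<le> n div 2\<close> by linarith
        then have "n \<le> 2 * (N - 2 * m)" using \<open>1 \<le> a\<close> unfolding N_def by linarith
        then show ?thesis by linarith
      qed
      ultimately have "min (2 ^ k * real l) (real n / 8) * (real n / 2) \<le> real m * real (N - 2 * m)"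
        by (intro mult_mono) auto
      also have "\<dots> = real (m * (N - 2 * m))" by simp
      also have "\<dots> \<le> real (card (arcs H))"
        using card_arcs_ft_bfp_heap_graph[OF _ m_le that] unfolding of_nat_le_iff
        by (simp add: a_def)
      finally have *: "min (2 ^ k * real l) (real n / 8) * (real n / 2) \<le> real (card (arcs H))" .
      have "1/16 * min (2 ^ k * real l * real n) ((real n)\<^sup>2)
          = min (2 ^ k * real l) (real n) / 8 * (real n / 2)"
        by (simp add: min_mult_distrib_right power2_eq_square)
      also have "\<dots> \<le> min (2 ^ k * real l) (real n / 8) * (real n / 2)"
        by (intro mult_right_mono) (auto simp: min_def)
      finally show ?thesis using * by simp
    qed
    have "card (verts heap_graph) = n" using card_verts_heap_graph \<open>1 \<le> a\<close> n by (simp add: N_def)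
    moreover have "0 \<in> verts heap_graph" by (simp add: heap_graph_def)
    ultimately show ?thesis using digraph_heap_graph bound by blast
  qed
qed simp

end
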